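(* Let $B=(\beta_{p-1},\ldots,\beta_0)$ be an alternate base. Then the set of distances between consecutive $B$-integers, that is, the set $\{x_{k+1}-x_k:k\in\mathbb N\}$ where $(x_k)_{k\in\mathbb N}$ is the increasing enumeration of the $B$-integers, is finite if and only if the base $B$ is Parry.
   Context: $\mathbb N=\{0,1,2,\dots\}$. An alternate base of period $p\ge1$ is a bi-infinite periodic sequence $B=(\beta_n)_{n\in\mathbb Z}$ of real numbers greater than $1$ with $\beta_{n+p}=\beta_n$ for all $n$; it is denoted $B=(\beta_{p-1},\ldots,\beta_0)$. For $N\in\mathbb Z$, $S^N(B)=(\beta_{n+N})_{n\in\mathbb Z}$. $B$-expansion $d_B(x)=(a_n)_{n\in\mathbb Z}$, written $\cdots a_1a_0\bullet a_{-1}a_{-2}\cdots$, of a real $x\ge0$. If $x\in[0,1)$: $a_n=0$ for $n\ge 0$, $r_{-1}=x$, and for $n\le -1$ iteratively $a_n=\lfloor\beta_n r_n\rfloor$, $r_{n-1}=\beta_n r_n-a_n$. If $x\ge 1$: let $N\ge0$ be minimal with $x<\beta_N\cdots\beta_0$, put $a_n=0$ for $n>N$, $r_N=x/(\beta_N\cdots\beta_0)$, and for $n\le N$ iteratively $a_n=\lfloor\beta_n r_n\rfloor$, $r_{n-1}=\beta_n r_n-a_n$. A $B$-integer is a real $x\ge0$ whose $B$-expansion has only zeros after the radix point ($a_n=0$ for all $n<0$). The set of $B$-integers is unbounded and has no accumulation point, so it can be enumerated increasingly. Quasi-greedy expansion of $1$: the limit $\lim_{x\to1^-}d_B(x)$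 (in the product topology) exists and has the form $0\bullet a_{-1}a_{-2}\cdots$; one sets $d_B^*(1)=a_{-1}a_{-2}\cdots$, an infinite word. The alternate base $B$ is called Parry if $d^*_{S^i(B)}(1)$ is eventually periodic for every $i\in\{0,\ldots,p-1\}$. *)

theory Defs
  imports "HOL-Analysis.Analysis"
begin

definition alternate_base :: "nat \<Rightarrow> (int \<Rightarrow> real) \<Rightarrow> bool" where
  "alternate_base p B \<longleftrightarrow> 1 \<le> p \<and> (\<forall>n. 1 < B n) \<and> (\<forall>n. B (n + int p) = B n)"

definition shift_base :: "int \<Rightarrow> (int \<Rightarrow> real) \<Rightarrow> int \<Rightarrow> real" where
  "shift_base N B = (\<lambda>n. B (n + N))"

text \<open>The remainder \<open>r\<^bsub>N - k\<^esub>\<close> of the greedy algorithm started at position \<open>N\<close> with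
  \<open>r\<^bsub>N\<^esub> = r\<close>.\<close>

primrec greedy_rem :: "(int \<Rightarrow> real) \<Rightarrow> int \<Rightarrow> real \<Rightarrow> nat \<Rightarrow> real" where
  "greedy_rem B N r 0 = r"
| "greedy_rem B N r (Suc k) =
     B (N - int k) * greedy_rem B N r k - of_int \<lfloor>B (N - int k) * greedy_rem B N r k\<rfloor>"

definition greedy_digit :: "(int \<Rightarrow> real) \<Rightarrow> int \<Rightarrow> real \<Rightarrow> int \<Rightarrow> int" where
  "greedy_digit B N r n = (if N < n then 0 else \<lfloor>B n * greedy_rem B N r (nat (N - n))\<rfloor>)"

text \<open>The \<open>B\<close>-expansion of \<open>x\<close>; it is meaningful for \<open>0 \<le> x\<close> only.\<close>

definition expansion :: "(int \<Rightarrow> real) \<Rightarrow> real \<Rightarrow> int \<Rightarrow> int" where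
  "expansion B x =
     (if x < 1 then greedy_digit B (-1) x
      else let N = (LEAST N::nat. x < (\<Prod>i\<le>N. B (int i)))
           in greedy_digit B (int N) (x / (\<Prod>i\<le>N. B (int i))))"

definition B_integers :: "(int \<Rightarrow> real) \<Rightarrow> real set" where
  "B_integers B = {x. 0 \<le> x \<and> (\<forall>n<0. expansion B x n = 0)}"

definition B_integer_seq :: "(int \<Rightarrow> real) \<Rightarrow> nat \<Rightarrow> real" where
  "B_integer_seq B = (THE x. strict_mono x \<and> range x = B_integers B)"

text \<open>The limit is taken in the function space \<open>int \<Rightarrow> int\<close>, whose topology in the library is
  the product of the discrete topologies. Entry \<open>k\<close> of the word is the digit at position
  \<open>-1 - k\<close>.\<close>

definition quasi_greedy_one :: "(int \<Rightarrow> real) \<Rightarrow> nat \<Rightarrow> int" where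
  "quasi_greedy_one B = (\<lambda>k. (THE a. (expansion B \<longlongrightarrow> a) (at_left 1)) (-1 - int k))"

definition eventually_periodic :: "(nat \<Rightarrow> 'a) \<Rightarrow> bool" where
  "eventually_periodic w \<longleftrightarrow> (\<exists>m q. 0 < q \<and> (\<forall>n\<ge>m. w (n + q) = w n))"

definition parry :: "nat \<Rightarrow> (int \<Rightarrow> real) \<Rightarrow> bool" where
  "parry p B \<longleftrightarrow> (\<forall>i<p. eventually_periodic (quasi_greedy_one (shift_base (int i) B)))"

end

theory Submission
  imports Defs
begin

text \<open>
  Put \<open>P\<^sub>n = \<beta>\<^sub>n\<^sub>-\<^sub>1 \<cdots> \<beta>\<^sub>0\<close> (\<open>weight B n\<close>). One step of the greedy algorithm shows that the
  \<open>B\<close>-integers below \<open>P\<^sub>n\<^sub>+\<^sub>1\<close> arise from those below \<open>P\<^sub>n\<close> by repeating them with period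
  \<open>P\<^sub>n\<close> and cutting off at \<open>P\<^sub>n\<^sub>+\<^sub>1\<close> (\<open>tiling\<close>, \<open>B_integers_eq\<close>). Passing from \<open>n\<close> to \<open>n + 1\<close>
  therefore creates only one new distance, the one between the largest \<open>B\<close>-integer below \<open>P\<^sub>n\<close>
  and \<open>P\<^sub>n\<close> itself. By the same recursion this distance is the remainder \<open>gap n\<close> after \<open>n\<close> steps
  of the quasi-greedy algorithm, with digits \<open>\<lceil>\<beta> r\<rceil> - 1\<close> in place of \<open>\<lfloor>\<beta> r\<rfloor>\<close>, applied to \<open>1\<close>
  with the bases \<open>\<beta>\<^sub>n\<^sub>-\<^sub>1, \<dots>, \<beta>\<^sub>0\<close> (\<open>largest_tile_point\<close>). So the set of distances is
  exactly \<open>{gap n | n \<in> \<nat>}\<close> (\<open>gap_set\<close>).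

  The greedy remainders of \<open>x\<close> tend from the left to the quasi-greedy remainders of \<open>1\<close> as
  \<open>x\<close> tends to \<open>1\<close> from the left, so the quasi-greedy digits are those of the limit expansion
  (\<open>quasi_greedy_one_eq\<close>). As \<open>gap n\<close> is the \<open>n\<close>-th remainder for the base shifted by
  \<open>n mod p\<close>, it remains to relate remainders and digits. If there are finitely many distances,
  then some remainder recurs at two positions congruent modulo \<open>p\<close>, from where on the digits
  repeat (\<open>eventually_periodic_digits\<close>). Conversely, let the digits be eventually periodic. The
  difference of two remainders a common multiple of the two periods apart is multiplied by some
  \<open>\<beta>\<^sub>j\<close> at every step and stays bounded by \<open>1\<close>; as the \<open>\<beta>\<^sub>j\<close> are bounded away from \<open>1\<close>, it
  is \<open>0\<close>, so there are only finitely many remainders (\<open>finite_remainders\<close>).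
\<close>

section \<open>Increasing enumerations of locally finite sets\<close>

text \<open>\<open>x\<close> and \<open>y\<close> are neighbours in \<open>S\<close>, with \<open>x\<close> the smaller one.\<close>

definition consecutive :: "real set \<Rightarrow> real \<Rightarrow> real \<Rightarrow> bool" where
  "consecutive S x y \<longleftrightarrow> x \<in> S \<and> y \<in> S \<and> x < y \<and> (\<forall>z\<in>S. \<not> (x < z \<and> z < y))"

lemma least_of_locally_finite:
  fixes S :: "real set"
  assumes fin: "\<And>b. finite {x \<in> S. x \<le> b}" and A: "A \<subseteq> S" "A \<noteq> {}"
  obtains m where "m \<in> A" "\<And>y. y \<in> A \<Longrightarrow> m \<le> y"
proof -
  obtain b where b: "b \<in> A" using A by blast
  let ?F = "{x \<in> A. x \<le> b}"
  have "finite ?F" by (rule finite_subset[OF _ fin[of b]]) (use A in auto)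
  moreover have "b \<in> ?F" using b by simp
  ultimately have "Min ?F \<in> ?F" and le: "\<And>y. y \<in> ?F \<Longrightarrow> Min ?F \<le> y"
    using Min_in[of ?F] by auto
  then have "Min ?F \<in> A" "\<And>y. y \<in> A \<Longrightarrow> Min ?F \<le> y"
    using \<open>b \<in> ?F\<close> by (auto, metis (mono_tags, lifting) linorder_le_cases mem_Collect_eq order_trans)
  then show thesis by (rule that)
qed

lemma strict_mono_enumeration_unique:
  fixes f g :: "nat \<Rightarrow> real"
  assumes "strict_mono f" "strict_mono g" "range f = range g"
  shows "f = g"
proof
  \<comment> \<open>Stated for arbitrary \<open>f\<close> and \<open>g\<close>, since it is used a second time with the roles exchanged.\<close>
  have le: "f n \<le> g n"
    if fg: "strict_mono f" "strict_mono g" "range f = range g" and eq: "\<And>j. j < n \<Longrightarrow> f j = g j"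
    for f g :: "nat \<Rightarrow> real" and n
  proof -
    obtain j where j: "g n = f j" using fg(3) by (metis rangeE rangeI)
    have "\<not> j < n" using j eq fg(2) by (metis less_irrefl strict_mono_less)
    then show ?thesis using j fg(1) by (simp add: strict_mono_less_eq)
  qed
  fix n
  show "f n = g n"
  proof (induction n rule: less_induct)
    case (less n)
    then show ?case using le[of f g n] le[of g f n] assms by (simp add: order_antisym)
  qed
qed

lemma locally_finite_enumeration:
  fixes S :: "real set"
  assumes fin: "\<And>b. finite {x \<in> S. x \<le> b}" and inf: "infinite S"
  obtains f :: "nat \<Rightarrow> real" where "strict_mono f" "range f = S"
proof -
  obtain m where m: "m \<in> S" "\<And>y. y \<in> S \<Longrightarrow> m \<le> y"
    using least_of_locally_finite[OF fin, of S] inf by (metis finite.emptyI order_refl)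
  have step: "\<exists>y. consecutive S x y" if "x \<in> S" for x
  proof -
    have "{y \<in> S. x < y} \<noteq> {}"
    proof
      assume "{y \<in> S. x < y} = {}"
      then have "S \<subseteq> {y \<in> S. y \<le> x}" by force
      then show False using fin inf finite_subset by blast
    qed
    then obtain y where "y \<in> {y \<in> S. x < y}" "\<And>z. z \<in> {y \<in> S. x < y} \<Longrightarrow> y \<le> z"
      using least_of_locally_finite[OF fin, of "{y \<in> S. x < y}"] by blast
    then show ?thesis using that unfolding consecutive_def by force
  qed
  obtain f where f: "\<And>n. f n \<in> S \<and> (n = 0 \<longrightarrow> f n = m)" "\<And>n. consecutive S (f n) (f (Suc n))"
    using dependent_nat_choice[of "\<lambda>n x. x \<in> S \<and> (n = 0 \<longrightarrow> x = m)" "\<lambda>n. consecutive S"] m(1) step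
    by (metis (no_types, lifting) Zero_not_Suc consecutive_def)
  have mono: "strict_mono f"
    using f(2) by (simp add: strict_mono_Suc_iff consecutive_def)
  \<comment> \<open>A point missed by \<open>f\<close> would lie above all \<open>f n\<close>, against local finiteness.\<close>
  have "x \<in> range f" if x: "x \<in> S" for x
  proof (rule ccontr)
    assume nx: "x \<notin> range f"
    have "f n < x" for n
    proof (induction n)
      case 0
      then show ?case using f(1)[of 0] m(2)[OF x] nx by (metis order_le_less rangeI)
    next
      case (Suc n)
      then show ?case using f(2)[of n] x nx unfolding consecutive_def
        by (metis linorder_neqE_linordered_idom rangeI)
    qed
    then have "range f \<subseteq> {y \<in> S. y \<le> x}" using f(1) by (auto intro: less_imp_le)
    then have "finite (range f)" using fin finite_subset by blast
    then show False using mono by (simp add: finite_image_iff strict_mono_imp_inj_on)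
  qed
  then have "range f = S" using f(1) by blast
  then show thesis using mono that by blast
qed

lemma gaps_of_enumeration:
  assumes f: "strict_mono f" "range f = S"
  shows "{f (Suc k) - f k |k. True} = {y - x |x y. consecutive S x y}"
proof -
  have "consecutive S (f k) (f (Suc k))" for k
  proof -
    have "\<not> (f k < f j \<and> f j < f (Suc k))" for j
      using f(1) by (auto simp: strict_mono_less)
    then have "\<forall>z\<in>S. \<not> (f k < z \<and> z < f (Suc k))" using f(2) by blast
    moreover have "f k \<in> S" "f (Suc k) \<in> S" using f(2) by auto
    moreover have "f k < f (Suc k)" using f(1) by (simp add: strict_mono_less)
    ultimately show ?thesis unfolding consecutive_def by simp
  qed
  moreover have "y - x \<in> {f (Suc k) - f k |k. True}" if c: "consecutive S x y" for x y
  proof -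
    obtain i j where ij: "x = f i" "y = f j"
      using c f(2) unfolding consecutive_def by blast
    have "i < j" using c f(1) ij unfolding consecutive_def by (simp add: strict_mono_less)
    moreover have "\<not> Suc i < j"
    proof
      assume "Suc i < j"
      then have "x < f (Suc i)" "f (Suc i) < y" using f(1) ij by (simp_all add: strict_mono_less)
      then show False using c f(2) unfolding consecutive_def by blast
    qed
    ultimately have "j = Suc i" by simp
    then show ?thesis using ij by auto
  qed
  ultimately show ?thesis
    by (intro subset_antisym subsetI) (elim CollectE exE conjE, simp, metis, elim CollectE exE conjE, simp)
qed

section \<open>Quasi-greedy remainders\<close>

text \<open>The greedy recursion with the floor replaced by the ceiling minus one: remainders stay in
  \<open>{0<..1}\<close> instead of \<open>{0..<1}\<close>.\<close>

primrec quasi_rem :: "(int \<Rightarrow> real) \<Rightarrow> int \<Rightarrow> real \<Rightarrow> nat \<Rightarrow> real" where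
  "quasi_rem B N r 0 = r"
| "quasi_rem B N r (Suc k) =
     B (N - int k) * quasi_rem B N r k - of_int (\<lceil>B (N - int k) * quasi_rem B N r k\<rceil> - 1)"

text \<open>The digit produced at step \<open>k\<close>, which is the digit at position \<open>N - k\<close>.\<close>

definition quasi_digit :: "(int \<Rightarrow> real) \<Rightarrow> int \<Rightarrow> real \<Rightarrow> nat \<Rightarrow> int" where
  "quasi_digit B N r k = \<lceil>B (N - int k) * quasi_rem B N r k\<rceil> - 1"

lemma quasi_rem_Suc:
  "quasi_rem B N r (Suc k) = B (N - int k) * quasi_rem B N r k - of_int (quasi_digit B N r k)"
  by (simp add: quasi_digit_def)

text \<open>Both recursions append a step at the end. The next two lemmas split off the first step instead,
  which suits inductions over the starting position.\<close>

lemma greedy_rem_first: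
  "greedy_rem B N r (Suc k) = greedy_rem B (N - 1) (B N * r - of_int \<lfloor>B N * r\<rfloor>) k"
proof (induction k)
  case (Suc k)
  have "N - 1 - int k = N - int (Suc k)" by simp
  then show ?case using Suc by (metis greedy_rem.simps(2))
qed simp

lemma quasi_rem_first:
  "quasi_rem B N r (Suc k) = quasi_rem B (N - 1) (B N * r - of_int (\<lceil>B N * r\<rceil> - 1)) k"
proof (induction k)
  case (Suc k)
  have "N - 1 - int k = N - int (Suc k)" by simp
  then show ?case using Suc by (metis quasi_rem.simps(2))
qed simp

lemma quasi_rem_bounds:
  assumes "0 < r" "r \<le> 1"
  shows "0 < quasi_rem B N r k \<and> quasi_rem B N r k \<le> 1"
proof (cases k)
  case (Suc j)
  let ?y = "B (N - int j) * quasi_rem B N r j"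
  have "of_int \<lceil>?y\<rceil> - 1 < ?y" "?y \<le> of_int \<lceil>?y\<rceil>" by linarith+
  then show ?thesis using Suc by simp
qed (use assms in simp)

lemma quasi_rem_shift: "quasi_rem (shift_base i B) N r k = quasi_rem B (N + i) r k"
  by (induction k) (simp_all add: shift_base_def algebra_simps)

lemma quasi_digit_shift: "quasi_digit (shift_base i B) N r k = quasi_digit B (N + i) r k"
  by (simp add: quasi_digit_def quasi_rem_shift) (simp add: shift_base_def algebra_simps)

text \<open>The left limit of the floor function at any point, integer or not, is the ceiling minus one;
  this is where the quasi-greedy digits come from.\<close>

lemma floor_eventually_at_left:
  fixes b y :: real
  assumes "0 < b"
  shows "\<forall>\<^sub>F r in at_left y. \<lfloor>b * r\<rfloor> = \<lceil>b * y\<rceil> - 1"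
proof -
  have "of_int (\<lceil>b * y\<rceil> - 1) < b * y" by linarith
  then have "of_int (\<lceil>b * y\<rceil> - 1) / b < y" using assms by (simp add: field_simps)
  from eventually_at_left_real[OF this] show ?thesis
  proof eventually_elim
    case (elim r)
    then have "of_int (\<lceil>b * y\<rceil> - 1) < b * r" "b * r < b * y"
      using assms by (simp_all add: field_simps)
    then show ?case by linarith
  qed
qed

lemma greedy_step_at_left:
  fixes b y :: real
  assumes "0 < b"
  shows "filterlim (\<lambda>r. b * r - of_int \<lfloor>b * r\<rfloor>) (at_left (b * y - of_int (\<lceil>b * y\<rceil> - 1))) (at_left y)"
proof -
  let ?d = "of_int (\<lceil>b * y\<rceil> - 1) :: real"
  have "((\<lambda>r. b * r - ?d) \<longlongrightarrow> b * y - ?d) (at_left y)"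
    by (intro tendsto_intros)
  moreover have "\<forall>\<^sub>F r in at_left y. b * r - ?d \<in> {..<b * y - ?d} \<and> b * r - ?d \<noteq> b * y - ?d"
    using assms by (simp add: eventually_at_filter)
  ultimately have "filterlim (\<lambda>r. b * r - ?d) (at_left (b * y - ?d)) (at_left y)"
    by (simp add: filterlim_at)
  moreover have "\<forall>\<^sub>F r in at_left y. b * r - of_int \<lfloor>b * r\<rfloor> = b * r - ?d"
    using floor_eventually_at_left[OF assms, of y] by eventually_elim simp
  ultimately show ?thesis by (subst filterlim_cong[OF refl refl])
qed

lemma greedy_rem_at_left:
  assumes "\<And>n. 0 < B n"
  shows "filterlim (\<lambda>x. greedy_rem B N x k) (at_left (quasi_rem B N r k)) (at_left r)"
proof (induction k)
  case 0
  then show ?case by (simp add: filterlim_ident)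
next
  case (Suc k)
  from filterlim_compose[OF greedy_step_at_left[OF assms] Suc] show ?case by simp
qed

lemma tendsto_fun_iff:
  fixes f :: "'a \<Rightarrow> 'b \<Rightarrow> 'c::topological_space"
  shows "(f \<longlongrightarrow> l) F \<longleftrightarrow> (\<forall>i. ((\<lambda>x. f x i) \<longlongrightarrow> l i) F)"
  using limitin_componentwise[of "\<lambda>_. euclidean" UNIV f l F]
  by (simp add: euclidean_product_topology limitin_canonical_iff)

lemma quasi_greedy_one_eq:
  assumes "\<And>n. 0 < B n"
  shows "quasi_greedy_one B = quasi_digit B (-1) 1"
proof -
  define a where "a n = (if -1 < n then 0 else quasi_digit B (-1) 1 (nat (-1 - n)))" for n
  have "((\<lambda>x. expansion B x n) \<longlongrightarrow> a n) (at_left 1)" for n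
  proof (rule tendsto_eventually)
    let ?k = "nat (-1 - n)"
    have lt: "\<forall>\<^sub>F x in at_left 1. x < (1::real)"
      by (simp add: eventually_at_filter)
    show "\<forall>\<^sub>F x in at_left 1. expansion B x n = a n"
    proof (cases "-1 < n")
      case True
      then show ?thesis using lt by (auto simp: expansion_def greedy_digit_def a_def elim: eventually_mono)
    next
      case False
      then have k: "-1 - int ?k = n" by simp
      have "\<forall>\<^sub>F x in at_left 1. \<lfloor>B n * greedy_rem B (-1) x ?k\<rfloor> = \<lceil>B n * quasi_rem B (-1) 1 ?k\<rceil> - 1"
        by (rule eventually_compose_filterlim[OF floor_eventually_at_left greedy_rem_at_left])
          (rule assms)+
      with lt show ?thesis
      proof eventually_elim
        case (elim x)
        then show ?case using False k by (simp add: expansion_def greedy_digit_def a_def quasi_digit_def)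
      qed
    qed
  qed
  then have lim: "(expansion B \<longlongrightarrow> a) (at_left 1)"
    by (simp add: tendsto_fun_iff)
  have "(THE a. (expansion B \<longlongrightarrow> a) (at_left 1)) = a"
  proof (rule the_equality)
    show "(expansion B \<longlongrightarrow> a) (at_left 1)" by (rule lim)
    show "b = a" if "(expansion B \<longlongrightarrow> b) (at_left 1)" for b
    proof
      fix n
      show "b n = a n" using that lim unfolding tendsto_fun_iff
        by (meson tendsto_unique trivial_limit_at_left_real)
    qed
  qed
  then show ?thesis by (auto simp: quasi_greedy_one_def a_def fun_eq_iff)
qed

section \<open>B-integers as a nested sequence of tilings\<close>

text \<open>The value of the digit \<open>1\<close> at position \<open>n\<close>.\<close>

definition weight :: "(int \<Rightarrow> real) \<Rightarrow> nat \<Rightarrow> real" where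
  "weight B n = (\<Prod>i<n. B (int i))"

text \<open>The \<open>B\<close>-integers below \<open>weight B n\<close>, as \<open>B_integers_eq\<close> and \<open>tiling_restrict\<close> justify. The
  points of \<open>tiling B (Suc n)\<close> are those whose residue modulo \<open>weight B n\<close> lies in
  \<open>tiling B n\<close>.\<close>

primrec tiling :: "(int \<Rightarrow> real) \<Rightarrow> nat \<Rightarrow> real set" where
  "tiling B 0 = {0}"
| "tiling B (Suc n) = {x. 0 \<le> x \<and> x < weight B (Suc n) \<and>
     x - of_int \<lfloor>x / weight B n\<rfloor> * weight B n \<in> tiling B n}"

declare tiling.simps(2) [simp del]

lemma weight_0 [simp]: "weight B 0 = 1" by (simp add: weight_def)
lemma weight_Suc: "weight B (Suc n) = B (int n) * weight B n" by (simp add: weight_def)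

locale alt_base =
  fixes p :: nat and B :: "int \<Rightarrow> real"
  assumes base: "alternate_base p B"
begin

lemma gt1: "1 < B n" using base by (simp add: alternate_base_def)
lemma pos: "0 < B n" using gt1[of n] by linarith
lemma p_pos: "0 < p" using base by (simp add: alternate_base_def)

lemma base_periodic: "B (n + int (p * t)) = B n"
proof (induction t)
  case (Suc t)
  have "B (n + int (p * Suc t)) = B ((n + int (p * t)) + int p)" by (simp add: algebra_simps)
  then show ?case using Suc base unfolding alternate_base_def by metis
qed simp

lemma uniform_bound: obtains c where "1 < c" "\<And>n. c \<le> B n"
proof
  let ?F = "B ` {0..<int p}"
  have ne: "finite ?F" "?F \<noteq> {}" using p_pos by auto
  show "1 < Min ?F" using ne gt1 by simp
  fix n
  have "B n = B (n mod int p)"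
  proof (cases "0 \<le> n")
    case True
    have "n = n mod int p + int (p * nat (n div int p))"
      using True p_pos by (simp add: pos_imp_zdiv_nonneg_iff)
    then show ?thesis using base_periodic by metis
  next
    case False
    then have "n div int p < 0" using p_pos by (simp add: pos_imp_zdiv_neg_iff)
    then have "n mod int p = n + int (p * nat (- (n div int p)))"
      by (simp add: minus_div_mult_eq_mod[symmetric] algebra_simps)
    then show ?thesis using base_periodic by metis
  qed
  moreover have "n mod int p \<in> {0..<int p}" using p_pos by simp
  ultimately show "Min ?F \<le> B n" using ne by simp
qed

text \<open>A bounded sequence that is multiplied by successive bases vanishes, because the bases are
  bounded away from \<open>1\<close>. It is applied to the remainders of an expansion ending in zeros and to
  differences of remainders with equal digits.\<close>

lemma expanding_bounded_zero:
  fixes d :: "nat \<Rightarrow> real"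
  assumes step: "\<And>j. d (Suc j) = B (N - int j) * d j" and bd: "\<And>j. \<bar>d j\<bar> \<le> 1"
  shows "d 0 = 0"
proof (rule ccontr)
  assume nz: "d 0 \<noteq> 0"
  obtain c where c: "1 < c" "\<And>n. c \<le> B n" using uniform_bound by blast
  have "c ^ j * \<bar>d 0\<bar> \<le> \<bar>d j\<bar>" for j
  proof (induction j)
    case (Suc j)
    have "c ^ Suc j * \<bar>d 0\<bar> = c * (c ^ j * \<bar>d 0\<bar>)" by simp
    also have "\<dots> \<le> B (N - int j) * \<bar>d j\<bar>"
      using Suc c pos[of "N - int j"] by (intro mult_mono) auto
    also have "\<dots> = \<bar>d (Suc j)\<bar>" using pos[of "N - int j"] by (simp add: step abs_mult)
    finally show ?case .
  qed simp
  moreover obtain j where "1 / \<bar>d 0\<bar> < c ^ j" using c(1) real_arch_pow by blast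
  ultimately show False using nz bd[of j] by (simp add: field_simps) (meson not_less order_trans)
qed

lemma weight_pos: "0 < weight B n" by (simp add: weight_def prod_pos pos)

lemma weight_less: "weight B n < weight B (Suc n)"
  using gt1[of "int n"] weight_pos[of n] by (simp add: weight_Suc)

lemma weight_strict_mono: "strict_mono (weight B)"
  by (simp add: strict_mono_Suc_iff weight_less)

lemma weight_mono: "m \<le> n \<Longrightarrow> weight B m \<le> weight B n"
  using weight_strict_mono by (simp add: strict_mono_less_eq)

lemma weight_unbounded: "\<exists>n. x < weight B n"
proof -
  obtain c where c: "1 < c" "\<And>n. c \<le> B n" using uniform_bound by blast
  have "c ^ n \<le> weight B n" for n
  proof (induction n)
    case (Suc n)
    then show ?case using c pos[of "int n"] unfolding weight_Suc power_Suc
      by (intro mult_mono) auto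
  qed simp
  then show ?thesis using real_arch_pow[OF c(1)] by (meson order_less_le_trans)
qed

lemma tiling_range: "x \<in> tiling B n \<Longrightarrow> 0 \<le> x \<and> x < weight B n"
  by (cases n) (auto simp: tiling.simps(2))

lemma zero_in_tiling: "0 \<in> tiling B n"
  by (induction n) (auto simp: weight_pos tiling.simps(2))

lemma floor_div_weight:
  assumes "0 \<le> z" "z < weight B n"
  shows "\<lfloor>(of_int a * weight B n + z) / weight B n\<rfloor> = a"
proof -
  have "(of_int a * weight B n + z) / weight B n = of_int a + z / weight B n"
    using weight_pos[of n] by (simp add: field_simps)
  moreover have "0 \<le> z / weight B n" "z / weight B n < 1"
    using assms weight_pos[of n] by simp_all
  ultimately show ?thesis by (simp add: floor_eq_iff)
qed

lemma tile_mem: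
  assumes "z \<in> tiling B n" "0 \<le> a" "of_int a * weight B n + z < weight B (Suc n)"
  shows "of_int a * weight B n + z \<in> tiling B (Suc n)"
  using assms tiling_range[OF assms(1)] floor_div_weight[of z n a] weight_pos[of n]
  by (simp add: tiling.simps(2))

lemma tile_memD:
  assumes "of_int a * weight B n + z \<in> tiling B (Suc n)" "0 \<le> z" "z < weight B n"
  shows "z \<in> tiling B n"
  using assms floor_div_weight[of z n a] by (simp add: tiling.simps(2))

lemma tile_decomp:
  assumes "x \<in> tiling B (Suc n)"
  obtains a z where "0 \<le> a" "z \<in> tiling B n" "x = of_int a * weight B n + z"
proof
  show "0 \<le> \<lfloor>x / weight B n\<rfloor>" using assms weight_pos[of n] by (simp add: tiling.simps(2))
  show "x - of_int \<lfloor>x / weight B n\<rfloor> * weight B n \<in> tiling B n"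
    using assms by (simp add: tiling.simps(2))
qed simp

lemma tiling_Suc_iff:
  assumes x: "x < weight B n"
  shows "x \<in> tiling B (Suc n) \<longleftrightarrow> x \<in> tiling B n"
proof
    assume "x \<in> tiling B n"
    then have "of_int 0 * weight B n + x \<in> tiling B (Suc n)"
      using x weight_less[of n] by (intro tile_mem) simp_all
    then show "x \<in> tiling B (Suc n)" by (simp only: of_int_0 mult_zero_left add_0_left)
  next
    assume "x \<in> tiling B (Suc n)"
    then show "x \<in> tiling B n"
      using x tile_memD[of 0 n x] tiling_range[of x "Suc n"] by (simp only: of_int_0 mult_zero_left add_0_left)
qed

lemma tiling_mono: "m \<le> n \<Longrightarrow> tiling B m \<subseteq> tiling B n"
proof (induction n rule: dec_induct)
  case (step n)
  then show ?case using tiling_Suc_iff tiling_range by blast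
qed simp

lemma tiling_restrict:
  assumes "x \<in> tiling B n" "x < weight B m"
  shows "x \<in> tiling B m"
proof (cases "m \<le> n")
  case True
  then show ?thesis using assms
  proof (induction n rule: dec_induct)
    case (step n)
    then have "x < weight B n" using weight_mono[of m n] by linarith
    then show ?case using step tiling_Suc_iff by blast
  qed simp
next
  case False
  then show ?thesis using assms tiling_mono[of n m] by auto
qed

lemma finite_tiling: "finite (tiling B n)"
proof (induction n)
  case (Suc n)
  have "tiling B (Suc n) \<subseteq> (\<lambda>(a, z). of_int a * weight B n + z) ` ({0..\<lceil>B (int n)\<rceil>} \<times> tiling B n)"
  proof
    fix x assume x: "x \<in> tiling B (Suc n)"
    then obtain a z where az: "0 \<le> a" "z \<in> tiling B n" "x = of_int a * weight B n + z"
      by (rule tile_decomp)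
    have "of_int a * weight B n < B (int n) * weight B n"
      using az(3) tiling_range[OF x] tiling_range[OF az(2)] unfolding weight_Suc by linarith
    then have "of_int a < B (int n)" using weight_pos[of n] by (simp only: mult_less_cancel_right_pos)
    then have "a \<in> {0..\<lceil>B (int n)\<rceil>}" using az(1) by simp linarith
    then show "x \<in> (\<lambda>(a, z). of_int a * weight B n + z) ` ({0..\<lceil>B (int n)\<rceil>} \<times> tiling B n)"
      using az by force
  qed
  then show ?case using Suc by (meson finite_SigmaI finite_atLeastAtMost_int finite_imageI finite_subset)
qed simp

text \<open>The greedy algorithm started at position \<open>n - 1\<close> reaches the radix point after \<open>n\<close> steps.\<close>

lemma greedy_rem_eq_0_iff:
  assumes "0 \<le> x" "x < weight B n"
  shows "greedy_rem B (int n - 1) (x / weight B n) n = 0 \<longleftrightarrow> x \<in> tiling B n"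
  using assms
proof (induction n arbitrary: x)
  case (Suc n)
  let ?z = "x - of_int \<lfloor>x / weight B n\<rfloor> * weight B n"
  have B: "B (int n) * (x / weight B (Suc n)) = x / weight B n"
    using pos[of "int n"] by (simp add: weight_Suc)
  have z: "x / weight B n - of_int \<lfloor>x / weight B n\<rfloor> = ?z / weight B n"
    using weight_pos[of n] by (simp add: field_simps)
  have "0 \<le> ?z / weight B n" "?z / weight B n < 1" unfolding z[symmetric] by linarith+
  then have "0 \<le> ?z" "?z < weight B n" using weight_pos[of n] by (simp_all add: zero_le_divide_iff)
  from Suc.IH[OF this] show ?case using Suc.prems
    unfolding greedy_rem_first by (simp add: B z tiling.simps(2) del: times_divide_eq_right)
qed simp

lemma greedy_rem_bounds:
  assumes "0 \<le> r" "r < 1"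
  shows "0 \<le> greedy_rem B N r k \<and> greedy_rem B N r k < 1"
proof (cases k)
  case (Suc j)
  let ?y = "B (N - int j) * greedy_rem B N r j"
  have "of_int \<lfloor>?y\<rfloor> \<le> ?y" "?y < of_int \<lfloor>?y\<rfloor> + 1" by linarith+
  then show ?thesis using Suc by (simp add: algebra_simps)
qed (use assms in simp)

lemma digits_zero_iff:
  assumes "0 \<le> r" "r < 1"
  shows "(\<forall>m<0. greedy_digit B (int n - 1) r m = 0) \<longleftrightarrow> greedy_rem B (int n - 1) r n = 0"
proof
  assume z: "\<forall>m<0. greedy_digit B (int n - 1) r m = 0"
  \<comment> \<open>Behind the radix point the digits vanish, so that the remainders are only multiplied.\<close>
  let ?d = "\<lambda>j. greedy_rem B (int n - 1) r (n + j)"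
  have "?d (Suc j) = B (-1 - int j) * ?d j" for j
  proof -
    have "greedy_digit B (int n - 1) r (-1 - int j) = 0" using z by simp
    moreover have "nat (int n - 1 - (-1 - int j)) = n + j" by simp
    ultimately have "\<lfloor>B (-1 - int j) * ?d j\<rfloor> = 0" unfolding greedy_digit_def by simp
    moreover have "int n - 1 - int (n + j) = -1 - int j" by simp
    ultimately show ?thesis unfolding add_Suc_right greedy_rem.simps by simp
  qed
  moreover have "\<bar>?d j\<bar> \<le> 1" for j using greedy_rem_bounds[OF assms, of "int n - 1" "n + j"] by simp
  ultimately show "greedy_rem B (int n - 1) r n = 0" using expanding_bounded_zero[of ?d "-1"] by simp
next
  assume z: "greedy_rem B (int n - 1) r n = 0"
  have d: "greedy_rem B (int n - 1) r (n + j) = 0" for j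
    by (induction j) (simp_all add: z)
  show "\<forall>m<0. greedy_digit B (int n - 1) r m = 0"
  proof (intro allI impI)
    fix m :: int assume "m < 0"
    then have "nat (int n - 1 - m) = n + nat (-1 - m)" by simp
    then show "greedy_digit B (int n - 1) r m = 0" using d by (simp add: greedy_digit_def)
  qed
qed

text \<open>The two cases in the definition of the expansion agree: \<open>n = 0\<close> covers \<open>x < 1\<close>, and otherwise
  \<open>n\<close> is one more than the leading position.\<close>

lemma expansion_eq:
  assumes "0 \<le> x"
  obtains n where "x < weight B n" "expansion B x = greedy_digit B (int n - 1) (x / weight B n)"
proof (cases "x < 1")
  case True
  then show thesis using that[of 0] by (simp add: expansion_def)
next
  case False
  have w: "(\<Prod>i\<le>N. B (int i)) = weight B (Suc N)" for N
    by (simp add: weight_def lessThan_Suc_atMost)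
  define N where "N = (LEAST N::nat. x < weight B (Suc N))"
  obtain m where "x < weight B m" using weight_unbounded by blast
  then have "x < weight B (Suc m)" using weight_less[of m] by linarith
  then have "x < weight B (Suc N)" unfolding N_def by (rule LeastI[of "\<lambda>N. x < weight B (Suc N)"])
  then show thesis using that[of "Suc N"] False by (simp add: expansion_def w N_def Let_def)
qed

lemma B_integers_eq: "B_integers B = (\<Union>n. tiling B n)"
proof -
  have "x \<in> B_integers B \<longleftrightarrow> (\<exists>n. x \<in> tiling B n)" if x: "0 \<le> x" for x
  proof -
    obtain n where n: "x < weight B n" "expansion B x = greedy_digit B (int n - 1) (x / weight B n)"
      using expansion_eq[OF x] by blast
    have "x \<in> B_integers B \<longleftrightarrow> x \<in> tiling B n"
      using digits_zero_iff[of "x / weight B n" n] greedy_rem_eq_0_iff[OF x n(1)] x n weight_pos[of n]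
      by (simp add: B_integers_def)
    then show ?thesis using tiling_restrict[OF _ n(1)] by blast
  qed
  moreover have "x \<notin> B_integers B" "x \<notin> tiling B n" if "\<not> 0 \<le> x" for x n
    using that tiling_range[of x n] by (auto simp: B_integers_def)
  ultimately have "x \<in> B_integers B \<longleftrightarrow> (\<exists>n. x \<in> tiling B n)" for x by metis
  then show ?thesis by (simp add: set_eq_iff)
qed

lemma tiling_B_integer: "x \<in> tiling B n \<Longrightarrow> x \<in> B_integers B"
  unfolding B_integers_eq by (rule UN_I[OF UNIV_I])

lemma B_integer_below: "z \<in> B_integers B \<Longrightarrow> z < weight B n \<Longrightarrow> z \<in> tiling B n"
  unfolding B_integers_eq by (metis UN_E tiling_restrict)

lemma multiple_in_B_integers:
  assumes "0 \<le> a" "of_int a * weight B n < weight B (Suc n)"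
  shows "of_int a * weight B n \<in> B_integers B"
proof -
  have "of_int a * weight B n + 0 \<in> tiling B (Suc n)"
    using tile_mem[OF zero_in_tiling assms(1), of n] assms(2) by (simp only: add_0_right)
  then have "of_int a * weight B n \<in> tiling B (Suc n)" by (simp only: add_0_right)
  then show ?thesis by (rule tiling_B_integer)
qed

lemma weight_in_B_integers: "weight B n \<in> B_integers B"
  using multiple_in_B_integers[of 1 n] weight_less[of n] by simp

lemma finite_B_integers_le: "finite {x \<in> B_integers B. x \<le> b}"
proof -
  obtain n where n: "b < weight B n" using weight_unbounded by blast
  have "{x \<in> B_integers B. x \<le> b} \<subseteq> tiling B n"
  proof
    fix x assume "x \<in> {x \<in> B_integers B. x \<le> b}"
    with n show "x \<in> tiling B n" by (intro B_integer_below) simp_all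
  qed
  then show ?thesis by (rule finite_subset[OF _ finite_tiling])
qed

lemma infinite_B_integers: "infinite (B_integers B)"
proof
  assume "finite (B_integers B)"
  moreover have "range (weight B) \<subseteq> B_integers B" using weight_in_B_integers by blast
  ultimately have "finite (range (weight B))" by (rule rev_finite_subset)
  then show False using weight_strict_mono by (simp add: finite_image_iff strict_mono_imp_inj_on)
qed

lemma B_integer_seq: "strict_mono (B_integer_seq B)" "range (B_integer_seq B) = B_integers B"
proof -
  obtain f :: "nat \<Rightarrow> real" where f: "strict_mono f" "range f = B_integers B"
    by (rule locally_finite_enumeration[OF finite_B_integers_le infinite_B_integers])
  have "B_integer_seq B = f"
    unfolding B_integer_seq_def
  proof (rule the_equality)
    show "strict_mono f \<and> range f = B_integers B" using f by simp
    show "g = f" if "strict_mono g \<and> range g = B_integers B" for g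
      using strict_mono_enumeration_unique[of g f] that f by simp
  qed
  then show "strict_mono (B_integer_seq B)" "range (B_integer_seq B) = B_integers B"
    using f by simp_all
qed

section \<open>Gaps are quasi-greedy remainders\<close>

text \<open>The largest \<open>B\<close>-integer strictly below \<open>y P\<^sub>n\<close> for \<open>0 < y \<le> 1\<close>. Only \<open>y = 1\<close> is needed
  later, but the induction runs through the remainders \<open>y\<close> of \<open>1\<close>.\<close>

lemma largest_tile_point:
  assumes "0 < y" "y \<le> 1"
  defines "m \<equiv> \<lambda>n y. y * weight B n - quasi_rem B (int n - 1) y n"
  shows "m n y \<in> tiling B n \<and> (\<forall>z\<in>tiling B n. z < y * weight B n \<longrightarrow> z \<le> m n y)"
  using assms(1,2)
proof (induction n arbitrary: y)
  case 0
  then show ?case by (simp add: m_def)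
next
  case (Suc n)
  \<comment> \<open>The point \<open>y P\<^sub>n\<^sub>+\<^sub>1\<close> lies in tile number \<open>?a\<close> or at its right end, at relative height \<open>?y\<close>.\<close>
  let ?a = "\<lceil>B (int n) * y\<rceil> - 1"
  let ?y = "B (int n) * y - of_int ?a"
  have y: "0 < ?y" "?y \<le> 1" by linarith+
  have "0 < B (int n) * y" using Suc.prems pos by simp
  then have a: "0 \<le> ?a" by linarith
  have eq: "y * weight B (Suc n) = of_int ?a * weight B n + ?y * weight B n"
    by (simp add: weight_Suc algebra_simps)
  have m: "m (Suc n) y = of_int ?a * weight B n + m n ?y"
    unfolding m_def eq quasi_rem_first by simp
  have mlt: "m n ?y < ?y * weight B n"
    using quasi_rem_bounds[OF y, of B "int n - 1" n] by (simp add: m_def)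
  have "y * weight B (Suc n) \<le> weight B (Suc n)" using Suc.prems weight_pos[of "Suc n"] by simp
  then have "m (Suc n) y \<in> tiling B (Suc n)" unfolding m
    using Suc.IH[OF y] a mlt eq by (intro tile_mem) linarith+
  moreover have "x \<le> m (Suc n) y" if x: "x \<in> tiling B (Suc n)" "x < y * weight B (Suc n)" for x
  proof -
    obtain b z where bz: "0 \<le> b" "z \<in> tiling B n" "x = of_int b * weight B n + z"
      using tile_decomp[OF x(1)] by blast
    have z: "0 \<le> z" "z < weight B n" using tiling_range[OF bz(2)] by auto
    have m0: "0 \<le> m n ?y" using Suc.IH[OF y] tiling_range by blast
    show ?thesis
    proof (cases b ?a rule: linorder_cases)
      case less
      then have "of_int (b + 1) * weight B n \<le> of_int ?a * weight B n"
        using weight_pos[of n] by (intro mult_right_mono) auto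
      then show ?thesis using z m0 bz(3) m by (simp add: algebra_simps)
    next
      case equal
      then show ?thesis using Suc.IH[OF y] bz x(2) eq m by auto
    next
      case greater
      then have "of_int (?a + 1) * weight B n \<le> of_int b * weight B n"
        using weight_pos[of n] by (intro mult_right_mono) auto
      moreover have "?y * weight B n \<le> 1 * weight B n"
        using y weight_pos[of n] by (intro mult_right_mono) auto
      moreover have "of_int (?a + 1) * weight B n = of_int ?a * weight B n + 1 * weight B n"
        by (simp only: of_int_add of_int_1 distrib_right)
      ultimately show ?thesis using z x(2) eq bz(3) by linarith
    qed
  qed
  ultimately show ?case by blast
qed

text \<open>By \<open>max_tiling\<close> below, the distance from \<open>weight B n\<close> down to the preceding \<open>B\<close>-integer.\<close>

abbreviation gap :: "nat \<Rightarrow> real" where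
  "gap n \<equiv> quasi_rem B (int n - 1) 1 n"

lemma max_tiling: "weight B n - gap n \<in> tiling B n"
  "z \<in> tiling B n \<Longrightarrow> z \<le> weight B n - gap n"
  using largest_tile_point[of 1 n] tiling_range[of z n] by auto

lemma gap_attained: "consecutive (B_integers B) (weight B n - gap n) (weight B n)"
  unfolding consecutive_def
proof (intro conjI ballI notI)
  show "weight B n - gap n \<in> B_integers B" using max_tiling(1) by (rule tiling_B_integer)
  show "weight B n \<in> B_integers B" by (rule weight_in_B_integers)
  show "weight B n - gap n < weight B n" using tiling_range max_tiling(1) by blast
  fix z assume "z \<in> B_integers B" "weight B n - gap n < z \<and> z < weight B n"
  then show False using B_integer_below[of z n] max_tiling(2)[of z n] by auto
qed

lemma consecutive_is_gap:
  assumes "consecutive (B_integers B) x y" "y \<in> tiling B n"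
  shows "y - x \<in> range gap"
  using assms
proof (induction n arbitrary: x y)
  case 0
  have "0 \<le> x" using 0 by (simp add: consecutive_def B_integers_def)
  then show ?case using 0 by (simp add: consecutive_def)
next
  case (Suc n)
  let ?w = "weight B n"
  have c: "x \<in> B_integers B" "x < y" "\<And>z. z \<in> B_integers B \<Longrightarrow> z < y \<Longrightarrow> z \<le> x"
    using Suc.prems(1) unfolding consecutive_def by force+
  have yr: "y < weight B (Suc n)" using tiling_range Suc.prems(2) by blast
  have xt: "x \<in> tiling B (Suc n)" using B_integer_below c yr by simp
  obtain a y' where ay: "0 \<le> a" "y' \<in> tiling B n" "y = of_int a * ?w + y'"
    using tile_decomp[OF Suc.prems(2)] by blast
  have y': "0 \<le> y'" "y' < ?w" using tiling_range[OF ay(2)] by auto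
  have add: "of_int b * ?w + z \<in> B_integers B"
    if "0 \<le> b" "z \<in> tiling B n" "of_int b * ?w + z < weight B (Suc n)" for b z
    using tile_mem[OF that(2,1,3)] by (rule tiling_B_integer)
  show ?case
  proof (cases "y' = 0")
    case False
    \<comment> \<open>Both points lie in tile number \<open>a\<close>; translating it to the origin lowers \<open>n\<close>.\<close>
    define x' where "x' = x - of_int a * ?w"
    have "of_int a * ?w \<in> B_integers B" using add[OF ay(1) zero_in_tiling] ay y' yr by simp
    then have x': "0 \<le> x'" using c(3) ay False y' by (simp add: x'_def)
    have xy: "x' < y'" using c(2) ay by (simp add: x'_def)
    have x't: "x' \<in> tiling B n" using tile_memD[of a n x'] xt x' xy y' by (simp add: x'_def)
    have "consecutive (B_integers B) x' y'" unfolding consecutive_def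
    proof (intro conjI ballI notI)
      show "x' \<in> B_integers B" "y' \<in> B_integers B" using x't ay(2) by (simp_all only: tiling_B_integer)
      fix z assume z: "z \<in> B_integers B" "x' < z \<and> z < y'"
      then have "z \<in> tiling B n" using B_integer_below y' by simp
      then have "of_int a * ?w + z \<in> B_integers B" using add ay z yr by simp
      then show False using c(3) z ay by (fastforce simp: x'_def)
    qed (rule xy)
    then have "y' - x' \<in> range gap" using ay(2) by (rule Suc.IH)
    moreover have "y - x = y' - x'" using ay(3) by (simp add: x'_def)
    ultimately show ?thesis by (simp only:)
  next
    case True
    \<comment> \<open>Here \<open>y\<close> is the left end of a tile, so \<open>x\<close> is the last point of the preceding tile.\<close>
    have "0 \<le> x" using c(1) by (simp add: B_integers_def)
    then have "a \<noteq> 0" using c(2) ay True by auto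
    then have a1: "0 \<le> a - 1" using ay by simp
    define x' where "x' = x - of_int (a - 1) * ?w"
    have "of_int (a - 1) * ?w + (?w - gap n) < y"
      using ay True quasi_rem_bounds[of 1 B "int n - 1" n] by (simp add: algebra_simps)
    then have le: "of_int (a - 1) * ?w + (?w - gap n) \<le> x"
      using c(3) add[OF a1 max_tiling(1)] yr by simp
    have "0 \<le> ?w - gap n" using max_tiling(1) tiling_range by blast
    then have "0 \<le> x'" using le by (simp add: x'_def)
    moreover have "x' < ?w" using c(2) ay True by (simp add: x'_def algebra_simps)
    ultimately have "x' \<in> tiling B n" using tile_memD[of "a - 1" n x'] xt by (simp add: x'_def)
    then have "x' = ?w - gap n" using max_tiling(2)[of x' n] le by (simp add: x'_def)
    then have "y - x = gap n" using ay True by (simp add: x'_def algebra_simps)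
    then show ?thesis by blast
  qed
qed

lemma gap_set: "{B_integer_seq B (Suc k) - B_integer_seq B k |k. True} = range gap"
proof -
  have "y - x \<in> range gap" if "consecutive (B_integers B) x y" for x y
  proof -
    have "y \<in> (\<Union>n. tiling B n)" using that B_integers_eq by (simp add: consecutive_def)
    then show ?thesis using consecutive_is_gap[OF that] by blast
  qed
  moreover have "\<exists>x y. gap n = y - x \<and> consecutive (B_integers B) x y" for n
    using gap_attained[of n] by (intro exI[of _ "weight B n - gap n"] exI[of _ "weight B n"]) simp
  ultimately show ?thesis unfolding gaps_of_enumeration[OF B_integer_seq] by blast
qed

section \<open>Finitely many remainders and periodic digits\<close>

lemma quasi_rem_periodic: "quasi_rem B (N + int (p * t)) r k = quasi_rem B N r k"
proof (induction k)
  case (Suc k)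
  have "N + int (p * t) - int k = (N - int k) + int (p * t)" by simp
  then have "B (N + int (p * t) - int k) = B (N - int k)" using base_periodic by metis
  then show ?case using Suc by simp
qed simp

text \<open>By periodicity, every gap is a remainder in one of only \<open>p\<close> quasi-greedy expansions of \<open>1\<close>.\<close>

lemma gap_eq: "gap n = quasi_rem B (int (n mod p) - 1) 1 n"
proof -
  have "int n - 1 = (int (n mod p) - 1) + int (p * (n div p))"
    by (metis add.commute add_diff_eq diff_add_eq mod_mult_div_eq of_nat_add)
  then show ?thesis using quasi_rem_periodic by metis
qed

lemma base_periodic_down: "B (N - int (k + p * t)) = B (N - int k)"
  using base_periodic[of "N - int (k + p * t)" t] by (simp add: algebra_simps)

lemma eventually_periodic_digits:
  assumes eq: "quasi_rem B N r (m + p * t) = quasi_rem B N r m" and t: "0 < t"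
  shows "eventually_periodic (quasi_digit B N r)"
proof -
  have rem: "quasi_rem B N r (m + j + p * t) = quasi_rem B N r (m + j)" for j
  proof (induction j)
    case (Suc j)
    then show ?case using base_periodic_down[of N "m + j" t] by (simp add: algebra_simps)
  qed (simp add: eq)
  have "quasi_digit B N r (n + p * t) = quasi_digit B N r n" if "m \<le> n" for n
    using rem[of "n - m"] that base_periodic_down[of N n t] by (simp add: quasi_digit_def)
  then show ?thesis unfolding eventually_periodic_def using t p_pos
    by (intro exI[of _ m] exI[of _ "p * t"]) simp
qed

lemma finite_remainders:
  assumes "eventually_periodic (quasi_digit B N 1)"
  shows "finite (range (quasi_rem B N 1))"
proof -
  let ?s = "quasi_rem B N 1" and ?a = "quasi_digit B N 1"
  obtain m q where q: "0 < q" "\<And>n. m \<le> n \<Longrightarrow> ?a (n + q) = ?a n"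
    using assms unfolding eventually_periodic_def by blast
  have dig: "?a (n + t * q) = ?a n" if "m \<le> n" for n t
  proof (induction t)
    case (Suc t)
    then show ?case using q(2)[of "n + t * q"] that by (simp add: algebra_simps)
  qed simp
  \<comment> \<open>\<open>p * q\<close> is a period of both the digits and the base.\<close>
  have per: "?s (n + p * q) = ?s n" if n: "m \<le> n" for n
  proof -
    let ?d = "\<lambda>j. ?s (n + j + p * q) - ?s (n + j)"
    have "?d (Suc j) = B (N - int n - int j) * ?d j" for j
      using dig[of "n + j" p] n base_periodic_down[of N "n + j" q]
      by (simp add: quasi_rem_Suc algebra_simps del: quasi_rem.simps)
    moreover have "\<bar>?d j\<bar> \<le> 1" for j
      using quasi_rem_bounds[of 1 B N "n + j"] quasi_rem_bounds[of 1 B N "n + j + p * q"] by linarith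
    ultimately have "?d 0 = 0" using expanding_bounded_zero[of ?d "N - int n"] by blast
    then show ?thesis by simp
  qed
  have "?s n \<in> ?s ` {..<m + p * q}" for n
  proof (induction n rule: less_induct)
    case (less n)
    show ?case
    proof (cases "n < m + p * q")
      case False
      then have "?s n = ?s (n - p * q)" using per[of "n - p * q"] by simp
      moreover have "n - p * q < n" using False q(1) p_pos by (metis add_leD2 diff_less less_le_trans nat_0_less_mult_iff not_less)
      ultimately show ?thesis using less by metis
    qed simp
  qed
  then show ?thesis by (meson finite_imageI finite_lessThan finite_subset image_subsetI)
qed

lemma parry_iff: "parry p B \<longleftrightarrow> (\<forall>i<p. eventually_periodic (quasi_digit B (int i - 1) 1))"
proof -
  have "quasi_greedy_one (shift_base (int i) B) = quasi_digit B (int i - 1) 1" for i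
    using quasi_greedy_one_eq[of "shift_base (int i) B"] pos
    by (simp add: quasi_digit_shift fun_eq_iff) (simp add: shift_base_def)
  then show ?thesis by (simp add: parry_def)
qed

lemma finite_gaps_iff: "finite (range gap) \<longleftrightarrow> parry p B"
proof
  assume fin: "finite (range gap)"
  show "parry p B" unfolding parry_iff
  proof (intro allI impI)
    fix i assume i: "i < p"
    \<comment> \<open>Only the remainders at positions congruent to \<open>i\<close> modulo \<open>p\<close> are gaps.\<close>
    let ?s = "\<lambda>t. quasi_rem B (int i - 1) 1 (i + p * t)"
    have "?s t \<in> range gap" for t
    proof -
      have "?s t = gap (i + p * t)" using gap_eq[of "i + p * t"] i by simp
      then show ?thesis by (rule range_eqI)
    qed
    then have "range ?s \<subseteq> range gap" by (rule image_subsetI)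
    then have "finite (range ?s)" using fin finite_subset by blast
    then have "\<not> inj ?s" using finite_imageD infinite_UNIV_nat by blast
    then obtain t t' where "t < t'" "?s t = ?s t'"
      by (metis (mono_tags, lifting) injI linorder_neqE_nat)
    moreover from this have "i + p * t' = (i + p * t) + p * (t' - t)"
      by (simp add: diff_mult_distrib2)
    ultimately show "eventually_periodic (quasi_digit B (int i - 1) 1)"
      using eventually_periodic_digits[of "int i - 1" 1 "i + p * t" "t' - t"] by simp
  qed
next
  assume "parry p B"
  then have "finite (\<Union>i<p. range (quasi_rem B (int i - 1) 1))"
    unfolding parry_iff using finite_remainders by simp
  moreover have "range gap \<subseteq> (\<Union>i<p. range (quasi_rem B (int i - 1) 1))"
    using gap_eq p_pos by (force intro: mod_less_divisor)
  ultimately show "finite (range gap)" by (rule rev_finite_subset)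
qed

end

theorem proposition19:
  fixes p :: nat and B :: "int \<Rightarrow> real"
  assumes "alternate_base p B"
  shows "finite {B_integer_seq B (Suc k) - B_integer_seq B k |k. True} \<longleftrightarrow> parry p B"
proof -
  interpret alt_base p B by unfold_locales (rule assms)
  show ?thesis unfolding gap_set by (rule finite_gaps_iff)
qed

end
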